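(* Let $\alpha,\beta,\gamma$ be complex numbers such that $\alpha+1$ is not a non-positive integer, $\Re\left(2\alpha-2\beta-2\gamma+\frac{\beta\gamma}{\alpha+1}+4\right)>0$, $2\alpha-\beta-\gamma+\frac{\beta\gamma}{\alpha+1}+3$ is not a non-positive integer, and $3\alpha+\alpha^2-\beta-\alpha\beta-\gamma-\alpha\gamma+\beta\gamma+2\neq0$. Then $$ {}_3F_2\!\left[\begin{matrix}\alpha,\ \beta,\ \gamma\\ \alpha+1,\ 2\alpha-\beta-\gamma+\frac{\beta\gamma}{\alpha+1}+3\end{matrix};1\right] =\frac{(\alpha+1)(\alpha-\beta+2)(\alpha-\gamma+2)}{(\alpha+2)(3\alpha+\alpha^2-\beta-\alpha\beta-\gamma-\alpha\gamma+\beta\gamma+2)}\; {}_3F_2\!\left[\begin{matrix}\alpha+2,\ \beta,\ \gamma\\ \alpha+3,\ 2\alpha-\beta-\gamma+\frac{\beta\gamma}{\alpha+1}+3\end{matrix};1\right]. $$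
   Context: For complex $a,b,c$ and complex $d,e$ that are not non-positive integers, ${}_3F_2\!\left[\begin{matrix}a,b,c\\ d,e\end{matrix};1\right]=\sum_{k=0}^{\infty}\frac{(a)_k(b)_k(c)_k}{k!\,(d)_k(e)_k}$, where $(x)_0=1$ and $(x)_k=x(x+1)\cdots(x+k-1)$ for $k\ge1$; the series converges when $\Re(d+e)>\Re(a+b+c)$. *)

theory Defs
  imports "HOL-Analysis.Analysis"
begin

text \<open>
  The value at unit argument of the generalized hypergeometric series with numerator parameters
  \<open>a, b, c\<close> and denominator parameters \<open>d, e\<close>.  It is meaningful for \<open>d, e\<close> not
  non-positive integers and a convergent series (e.g. \<open>Re (d + e) > Re (a + b + c)\<close>);
  outside this range the value is an artefact of \<open>suminf\<close> and of division by zero.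
\<close>

definition hypergeom_3F2_at_1 ::
  "complex \<Rightarrow> complex \<Rightarrow> complex \<Rightarrow> complex \<Rightarrow> complex \<Rightarrow> complex" where
  "hypergeom_3F2_at_1 a b c d e =
     (\<Sum>k. (pochhammer a k * pochhammer b k * pochhammer c k) /
           (fact k * pochhammer d k * pochhammer e k))"

end

theory Submission
  imports Defs
begin

text \<open>
  Up to a factor, both series have the terms \<open>t k / (c + k)\<close> with
  \<open>t k = (\<beta>)\<^sub>k (\<gamma>)\<^sub>k / (k! (e)\<^sub>k)\<close>, where \<open>c\<close> is \<open>\<alpha>\<close> on the left and
  \<open>\<alpha> + 2\<close> on the right.  The choice of the denominator parameter \<open>e\<close> is exactly what makes the
  difference of the two sides a telescoping series: the sum of its terms up to index \<open>n\<close> is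
  \<open>(\<beta> + n) (\<gamma> + n) t n / ((e - \<alpha> - 1) (\<alpha> + n + 1) (\<alpha> + n + 2))\<close>, which tends to \<open>0\<close>
  since \<open>t n\<close> has the order of growth \<open>n powr Re (\<beta> + \<gamma> - e - 1)\<close>.
\<close>

text \<open>With \<open>a = d = 1\<close> the first numerator and first denominator symbols cancel,
  which gives the \<open>t k\<close> of the overview. A growth estimate for the general term
  therefore covers both series and the boundary term.\<close>

definition hypergeom_term ::
  "complex \<Rightarrow> complex \<Rightarrow> complex \<Rightarrow> complex \<Rightarrow> complex \<Rightarrow> nat \<Rightarrow> complex" where
  "hypergeom_term a b c d e k =
     (pochhammer a k * pochhammer b k * pochhammer c k) /
     (fact k * pochhammer d k * pochhammer e k)"

text \<open>Gauss's limit formula for the Gamma function, since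
  \<open>pochhammer z n / fact n\<close> is the binomial coefficient of \<open>z - 1 + n\<close>
  over \<open>n\<close>. The exponential is \<open>n\<close> to the power
  \<open>1 - z\<close>.\<close>

lemma pochhammer_asymptotic:
  fixes z :: complex
  shows "(\<lambda>n. pochhammer z n / fact n * exp ((1 - z) * of_real (ln (of_nat n)))) \<longlonglongrightarrow> rGamma z"
  using Gamma_gbinomial[of "z - 1"] by (simp add: gbinomial_pochhammer')

text \<open>Apply the previous limit to all five parameters: three factorials against two leave the
  single \<open>fact n\<close>, and the exponents \<open>1 - z\<close> add up to
  \<open>d + e - a - b - c + 1\<close>. The limits in the denominator are nonzero because
  \<open>rGamma\<close> vanishes only at non-positive integers.\<close>

lemma hypergeom_term_asymptotic:
  assumes "d \<notin> \<int>\<^sub>\<le>\<^sub>0" "e \<notin> \<int>\<^sub>\<le>\<^sub>0"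
  shows "(\<lambda>n. hypergeom_term a b c d e n *
            exp ((d + e - a - b - c + 1) * of_real (ln (of_nat n)))) \<longlonglongrightarrow>
         rGamma a * rGamma b * rGamma c / (rGamma d * rGamma e)"
proof -
  let ?p = "\<lambda>z n. pochhammer z n / fact n * exp ((1 - z) * of_real (ln (of_nat n))) :: complex"
  have "?p a n * ?p b n * ?p c n / (?p d n * ?p e n) =
        hypergeom_term a b c d e n * exp ((d + e - a - b - c + 1) * of_real (ln (of_nat n)))" for n
  proof -
    have "(1 - a) + (1 - b) + (1 - c) - ((1 - d) + (1 - e)) = d + e - a - b - c + 1"
      by simp
    then have "exp ((d + e - a - b - c + 1) * L) =
        exp ((1 - a) * L) * exp ((1 - b) * L) * exp ((1 - c) * L) /
        (exp ((1 - d) * L) * exp ((1 - e) * L))" for L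
      by (metis exp_add exp_diff distrib_right left_diff_distrib)
    then show ?thesis
      by (simp only: hypergeom_term_def) (simp add: ac_simps)
  qed
  moreover have "(\<lambda>n. ?p a n * ?p b n * ?p c n / (?p d n * ?p e n)) \<longlonglongrightarrow>
      rGamma a * rGamma b * rGamma c / (rGamma d * rGamma e)"
    using assms by (intro tendsto_intros pochhammer_asymptotic) (simp_all add: rGamma_eq_zero_iff)
  ultimately show ?thesis by (simp only:)
qed

lemma hypergeom_term_bound:
  assumes "d \<notin> \<int>\<^sub>\<le>\<^sub>0" "e \<notin> \<int>\<^sub>\<le>\<^sub>0"
  obtains B where "\<And>n. n > 0 \<Longrightarrow>
    norm (hypergeom_term a b c d e n) \<le> B * real n powr - (Re (d + e - a - b - c) + 1)"
proof -
  have "Bseq (\<lambda>n. hypergeom_term a b c d e n *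
            exp ((d + e - a - b - c + 1) * of_real (ln (of_nat n))))"
    using hypergeom_term_asymptotic[OF assms] by (intro convergent_imp_Bseq convergentI)
  then obtain B where B: "\<forall>n. norm (hypergeom_term a b c d e n *
            exp ((d + e - a - b - c + 1) * of_real (ln (of_nat n)))) \<le> B"
    by (rule BseqE)
  have "norm (hypergeom_term a b c d e n) \<le> B * real n powr - (Re (d + e - a - b - c) + 1)"
    if "n > 0" for n
  proof -
    have "norm (hypergeom_term a b c d e n) * real n powr (Re (d + e - a - b - c) + 1) \<le> B"
      using B[rule_format, of n] that by (simp add: norm_mult powr_def)
    then show ?thesis
      using that unfolding powr_minus by (simp add: field_simps)
  qed
  then show thesis by (rule that)
qed

lemma summable_hypergeom_term:
  assumes "d \<notin> \<int>\<^sub>\<le>\<^sub>0" "e \<notin> \<int>\<^sub>\<le>\<^sub>0" "Re (d + e - a - b - c) > 0"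
  shows "summable (hypergeom_term a b c d e)"
proof -
  obtain B where B: "\<And>n. n > 0 \<Longrightarrow>
      norm (hypergeom_term a b c d e n) \<le> B * real n powr - (Re (d + e - a - b - c) + 1)"
    using hypergeom_term_bound[OF assms(1,2)] by blast
  have "summable (\<lambda>n. B * real n powr - (Re (d + e - a - b - c) + 1))"
    using assms(3) by (intro summable_mult) (simp add: summable_real_powr_iff)
  then show ?thesis
    using B by (rule summable_comparison_test'[where N = 1]) simp
qed

text \<open>The bound \<open>-1\<close> is one lower than in the summability lemma. The boundary
  term needs this: the parametric excess of \<open>t\<close> is one less than that of the two
  series.\<close>

lemma hypergeom_term_tendsto_0:
  assumes "d \<notin> \<int>\<^sub>\<le>\<^sub>0" "e \<notin> \<int>\<^sub>\<le>\<^sub>0" "Re (d + e - a - b - c) > -1"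
  shows "hypergeom_term a b c d e \<longlonglongrightarrow> 0"
proof -
  obtain B where B: "\<And>n. n > 0 \<Longrightarrow>
      norm (hypergeom_term a b c d e n) \<le> B * real n powr - (Re (d + e - a - b - c) + 1)"
    using hypergeom_term_bound[OF assms(1,2)] by blast
  have "(\<lambda>n. real n powr - (Re (d + e - a - b - c) + 1)) \<longlonglongrightarrow> 0"
    using assms(3) by (intro tendsto_neg_powr filterlim_real_sequentially) simp
  then have "(\<lambda>n. B * real n powr - (Re (d + e - a - b - c) + 1)) \<longlonglongrightarrow> 0"
    by (rule tendsto_mult_right_zero)
  then show ?thesis
    by (rule Lim_null_comparison[rotated])
       (use B in \<open>auto intro: eventually_sequentiallyI[of 1]\<close>)
qed

lemma hypergeom_term_Suc:
  "hypergeom_term a b c d e (Suc n) = hypergeom_term a b c d e n *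
     ((a + of_nat n) * (b + of_nat n) * (c + of_nat n) /
      ((1 + of_nat n) * (d + of_nat n) * (e + of_nat n)))"
  by (simp add: hypergeom_term_def pochhammer_Suc ac_simps)

text \<open>The quotient of \<open>pochhammer a n\<close> by \<open>pochhammer (a + 1) n\<close>
  telescopes to \<open>a / (a + n)\<close>. The equation is kept multiplied out because
  \<open>a + n\<close> vanishes when \<open>a = 0\<close> and \<open>n = 0\<close>.\<close>

lemma hypergeom_term_contiguous:
  assumes "a + 1 \<notin> \<int>\<^sub>\<le>\<^sub>0"
  shows "(a + of_nat n) * hypergeom_term a b c (a + 1) e n = a * hypergeom_term 1 b c 1 e n"
proof -
  have "pochhammer (a + 1) n \<noteq> 0"
    using assms pochhammer_eq_0_imp_nonpos_Int by blast
  moreover have "(a + of_nat n) * pochhammer a n = a * pochhammer (a + 1) n"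
    using pochhammer_rec[of a n] pochhammer_rec'[of a n] by simp
  ultimately have "(a + of_nat n) * (pochhammer a n / pochhammer (a + 1) n) = a"
    by (simp add: divide_simps)
  moreover have "(a + of_nat n) * hypergeom_term a b c (a + 1) e n =
      ((a + of_nat n) * (pochhammer a n / pochhammer (a + 1) n)) * hypergeom_term 1 b c 1 e n"
    by (simp add: hypergeom_term_def pochhammer_fact[symmetric]) (simp add: ac_simps)
  ultimately show ?thesis
    by simp
qed

lemma plus_of_nat_nonzero:
  fixes z :: complex
  assumes "z \<notin> \<int>\<^sub>\<le>\<^sub>0"
  shows "z + of_nat n \<noteq> 0"
  using assms plus_of_nat_eq_0_imp by blast

lemma nonpos_Ints_add_of_nat:
  fixes z :: complex
  assumes "z \<notin> \<int>\<^sub>\<le>\<^sub>0"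
  shows "z + of_nat n \<notin> \<int>\<^sub>\<le>\<^sub>0"
proof
  assume "z + of_nat n \<in> \<int>\<^sub>\<le>\<^sub>0"
  then obtain m where "z + of_nat n = - of_nat m"
    by (elim nonpos_Ints_cases')
  then have "z + of_nat (n + m) = 0"
    by (simp add: add.assoc[symmetric])
  then show False
    using plus_of_nat_nonzero[OF assms] by blast
qed

text \<open>Hypothesis \<open>eq\<close> is the definition of \<open>e\<close> cleared of its
  denominator. All terms are rational multiples of \<open>t\<close>, so induction on
  \<open>n\<close> reduces the claim to an identity of rational functions in
  \<open>n\<close>.\<close>

lemma hypergeom_difference_partial_sum:
  fixes \<alpha> \<beta> \<gamma> e :: complex
  assumes \<alpha>: "\<alpha> + 1 \<notin> \<int>\<^sub>\<le>\<^sub>0" and e: "e \<notin> \<int>\<^sub>\<le>\<^sub>0"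
    and e_ne: "e \<noteq> \<alpha> + 1"
    and eq: "\<beta> * \<gamma> = (\<alpha> + 1) * (e - 2 * \<alpha> + \<beta> + \<gamma> - 3)"
  shows "(\<Sum>k\<le>n. hypergeom_term \<alpha> \<beta> \<gamma> (\<alpha> + 1) e k -
            (\<alpha> - \<beta> + 2) * (\<alpha> - \<gamma> + 2) / ((\<alpha> + 2) * (e - \<alpha> - 1)) *
            hypergeom_term (\<alpha> + 2) \<beta> \<gamma> (\<alpha> + 3) e k) =
         (\<beta> + of_nat n) * (\<gamma> + of_nat n) /
         ((e - \<alpha> - 1) * (\<alpha> + of_nat n + 1) * (\<alpha> + of_nat n + 2)) *
         hypergeom_term 1 \<beta> \<gamma> 1 e n" (is "(\<Sum>k\<le>n. ?u k) = ?H n")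
proof -
  define t where "t = hypergeom_term 1 \<beta> \<gamma> 1 e"
  have ne: "\<alpha> + 1 + of_nat k \<noteq> 0" "e + of_nat k \<noteq> 0" for k
    using \<alpha> e by (auto dest: plus_of_nat_nonzero)
  have ne2: "\<alpha> + 2 + of_nat k \<noteq> 0" "\<alpha> + 3 + of_nat k \<noteq> 0" for k
    using ne(1)[of "Suc k"] ne(1)[of "Suc (Suc k)"] by (simp_all add: add_ac)
  have \<alpha>3: "\<alpha> + 2 + 1 \<notin> \<int>\<^sub>\<le>\<^sub>0"
    using nonpos_Ints_add_of_nat[OF \<alpha>, of 2] by (simp add: add_ac)
  have d: "e - \<alpha> - 1 \<noteq> 0" using e_ne by (simp add: algebra_simps)
  have term2: "hypergeom_term (\<alpha> + 2) \<beta> \<gamma> (\<alpha> + 3) e k = (\<alpha> + 2) / (\<alpha> + 2 + of_nat k) * t k" for k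
    using hypergeom_term_contiguous[OF \<alpha>3, of k \<beta> \<gamma> e] ne2(1)[of k]
    by (simp add: t_def field_simps)
  \<comment> \<open>Restricted to successors: at index 0 with \<alpha> = 0 the term is 1, while the
    right-hand side would be \<open>0 / 0 = 0\<close>. The base case below therefore unfolds the
    definition instead.\<close>
  have term1: "hypergeom_term \<alpha> \<beta> \<gamma> (\<alpha> + 1) e (Suc k) = \<alpha> / (\<alpha> + 1 + of_nat k) * t (Suc k)" for k
    using hypergeom_term_contiguous[OF \<alpha>, of "Suc k" \<beta> \<gamma> e] ne(1)[of k]
    by (simp add: t_def field_simps)
  have a2: "\<alpha> + 2 \<noteq> 0" "\<alpha> + 1 \<noteq> 0" using ne2(1)[of 0] ne(1)[of 0] by simp_all
  show ?thesis
  proof (induction n)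
    case 0
    \<comment> \<open>The claim for \<open>n = 0\<close>, cleared of denominators.\<close>
    have "(\<alpha> + 1) * ((e - \<alpha> - 1) * (\<alpha> + 2) - (\<alpha> - \<beta> + 2) * (\<alpha> - \<gamma> + 2)) = \<beta> * \<gamma>"
      using eq by algebra
    then show ?case
      using d a2 by (simp add: hypergeom_term_def divide_simps) (simp add: algebra_simps)
  next
    case (Suc n)
    define x :: complex where "x = of_nat n"
    have nx: "\<alpha> + 1 + x \<noteq> 0" "\<alpha> + 2 + x \<noteq> 0" "\<alpha> + 3 + x \<noteq> 0" "1 + x \<noteq> 0" "e + x \<noteq> 0"
      using ne[of n] ne2[of n] of_nat_neq_0[of n, where 'a = complex]
      by (simp_all add: x_def add_ac)
    define N where "N = (\<alpha> - \<beta> + 2) * (\<alpha> - \<gamma> + 2)"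
    define \<delta> where "\<delta> = e - \<alpha> - 1"
    \<comment> \<open>\<open>P\<close> is \<open>t (Suc n)\<close> written through
      \<open>t n\<close>. It is factored out of all three terms rather than divided by, as it may be
      zero.\<close>
    define P where "P = (\<beta> + x) * (\<gamma> + x) * t n / ((1 + x) * (e + x))"
    \<comment> \<open>This is \<open>key\<close> below multiplied by \<delta> and the three linear
      factors. The cubic coefficients in \<open>x\<close> agree on sight; \<open>eq\<close> makes
      the lower ones agree.\<close>
    have "(1 + x) * (e + x) * (\<alpha> + 3 + x) +
          (\<alpha> * \<delta> * (\<alpha> + 3 + x) - N * (\<alpha> + 1 + x)) * (\<alpha> + 2 + x) =
          (\<beta> + 1 + x) * (\<gamma> + 1 + x) * (\<alpha> + 1 + x)"
      unfolding N_def \<delta>_def using eq by algebra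
    moreover have "\<delta> \<noteq> 0" using d by (simp add: \<delta>_def)
    ultimately have key: "(1 + x) * (e + x) / (\<delta> * (\<alpha> + 1 + x) * (\<alpha> + 2 + x)) +
          (\<alpha> / (\<alpha> + 1 + x) - N / (\<delta> * (\<alpha> + 3 + x))) =
          (\<beta> + 1 + x) * (\<gamma> + 1 + x) / (\<delta> * (\<alpha> + 2 + x) * (\<alpha> + 3 + x))"
      using nx by (simp add: divide_simps) algebra
    have t_Suc: "t (Suc n) = P"
      by (simp add: t_def P_def x_def hypergeom_term_Suc divide_simps)
    have "?H n = (1 + x) * (e + x) / (\<delta> * (\<alpha> + 1 + x) * (\<alpha> + 2 + x)) * P"
      using nx by (simp add: P_def t_def \<delta>_def x_def[symmetric] add_ac)
    moreover have "?u (Suc n) = (\<alpha> / (\<alpha> + 1 + x) - N / (\<delta> * (\<alpha> + 3 + x))) * P"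
    proof -
      have "\<alpha> + 2 + of_nat (Suc n) = \<alpha> + 3 + x"
        by (simp add: x_def)
      then show ?thesis
        unfolding term1 term2 t_Suc N_def[symmetric] \<delta>_def[symmetric] x_def[symmetric]
        using a2 by (simp add: left_diff_distrib)
    qed
    moreover have "?H (Suc n) = (\<beta> + 1 + x) * (\<gamma> + 1 + x) / (\<delta> * (\<alpha> + 2 + x) * (\<alpha> + 3 + x)) * P"
      by (simp add: t_def[symmetric] t_Suc \<delta>_def x_def[symmetric] add_ac)
    ultimately show ?case
      unfolding sum.atMost_Suc Suc.IH using key by (metis distrib_right)
  qed
qed

theorem theorem10:
  fixes \<alpha> \<beta> \<gamma> :: complex
  assumes "\<alpha> + 1 \<notin> \<int>\<^sub>\<le>\<^sub>0"
    and "Re (2 * \<alpha> - 2 * \<beta> - 2 * \<gamma> + \<beta> * \<gamma> / (\<alpha> + 1) + 4) > 0"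
    and "2 * \<alpha> - \<beta> - \<gamma> + \<beta> * \<gamma> / (\<alpha> + 1) + 3 \<notin> \<int>\<^sub>\<le>\<^sub>0"
    and "3 * \<alpha> + \<alpha>^2 - \<beta> - \<alpha> * \<beta> - \<gamma> - \<alpha> * \<gamma> + \<beta> * \<gamma> + 2 \<noteq> 0"
  shows "hypergeom_3F2_at_1 \<alpha> \<beta> \<gamma>
           (\<alpha> + 1) (2 * \<alpha> - \<beta> - \<gamma> + \<beta> * \<gamma> / (\<alpha> + 1) + 3) =
         ((\<alpha> + 1) * (\<alpha> - \<beta> + 2) * (\<alpha> - \<gamma> + 2)) /
         ((\<alpha> + 2) * (3 * \<alpha> + \<alpha>^2 - \<beta> - \<alpha> * \<beta> - \<gamma> - \<alpha> * \<gamma> + \<beta> * \<gamma> + 2)) *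
         hypergeom_3F2_at_1 (\<alpha> + 2) \<beta> \<gamma>
           (\<alpha> + 3) (2 * \<alpha> - \<beta> - \<gamma> + \<beta> * \<gamma> / (\<alpha> + 1) + 3)"
proof -
  define e where "e = 2 * \<alpha> - \<beta> - \<gamma> + \<beta> * \<gamma> / (\<alpha> + 1) + 3"
  define Q where "Q = 3 * \<alpha> + \<alpha>^2 - \<beta> - \<alpha> * \<beta> - \<gamma> - \<alpha> * \<gamma> + \<beta> * \<gamma> + 2"
  define C where "C = (\<alpha> - \<beta> + 2) * (\<alpha> - \<gamma> + 2) / ((\<alpha> + 2) * (e - \<alpha> - 1))"
  define D where "D = (\<lambda>n. (\<beta> + of_nat n) * (\<gamma> + of_nat n) /
      ((e - \<alpha> - 1) * (\<alpha> + of_nat n + 1) * (\<alpha> + of_nat n + 2)))"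
  have e: "e \<notin> \<int>\<^sub>\<le>\<^sub>0"
    using assms(3) by (simp add: e_def)
  have \<alpha>1: "\<alpha> + 1 \<noteq> 0"
    using assms(1) by auto
  have eq: "\<beta> * \<gamma> = (\<alpha> + 1) * (e - 2 * \<alpha> + \<beta> + \<gamma> - 3)"
    using \<alpha>1 by (simp add: e_def)
  \<comment> \<open>This factorization turns the nonvanishing hypothesis into e \<noteq> \<alpha> +
    1, and later identifies \<open>C\<close> with the coefficient in the theorem.\<close>
  have Q: "Q = (\<alpha> + 1) * (e - \<alpha> - 1)"
    unfolding Q_def using eq by algebra
  then have "e \<noteq> \<alpha> + 1"
    using assms(4) by (auto simp: Q_def)
  have \<alpha>3: "\<alpha> + 3 \<notin> \<int>\<^sub>\<le>\<^sub>0"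
    using nonpos_Ints_add_of_nat[OF assms(1), of 2] by (simp add: add_ac)
  \<comment> \<open>The real part in the hypothesis is the common parametric excess of both series.
    For \<open>t\<close> the excess is e - \<beta> - \<gamma>, with real part above -1.\<close>
  have conv: "Re (e + 1 - \<beta> - \<gamma>) > 0"
    using assms(2) by (simp add: e_def)
  have sm1: "summable (hypergeom_term \<alpha> \<beta> \<gamma> (\<alpha> + 1) e)"
    using conv by (intro summable_hypergeom_term assms e) simp
  have sm2: "summable (hypergeom_term (\<alpha> + 2) \<beta> \<gamma> (\<alpha> + 3) e)"
    using conv by (intro summable_hypergeom_term \<alpha>3 e) simp
  have "(\<lambda>n. \<Sum>k\<le>n. hypergeom_term \<alpha> \<beta> \<gamma> (\<alpha> + 1) e k -
            C * hypergeom_term (\<alpha> + 2) \<beta> \<gamma> (\<alpha> + 3) e k) \<longlonglongrightarrow> 0"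
  proof -
    have "(\<lambda>n. (z + of_nat n) / of_nat n) \<longlonglongrightarrow> 1" for z :: complex
    proof -
      have "(\<lambda>n. z / of_nat n + 1) \<longlonglongrightarrow> 0 + 1"
        by (intro tendsto_intros lim_const_over_n)
      moreover have "\<forall>\<^sub>F n in sequentially. z / of_nat n + 1 = (z + of_nat n) / of_nat n"
        using eventually_gt_at_top[of 0] by eventually_elim (simp add: field_simps)
      ultimately show ?thesis
        by (auto intro: Lim_transform_eventually)
    qed
    note lim = this
    have "D \<longlonglongrightarrow> 1 * 1 / ((e - \<alpha> - 1) * 1 * 1)"
    proof (rule Lim_transform_eventually)
      \<comment> \<open>For positive \<open>n\<close>, numerator and denominator of
        \<open>D n\<close> are divided by the square of \<open>n\<close>, so every factor depending
        on \<open>n\<close> tends to 1.\<close>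
      show "(\<lambda>n. ((\<beta> + of_nat n) / of_nat n) * ((\<gamma> + of_nat n) / of_nat n) /
          ((e - \<alpha> - 1) * ((\<alpha> + 1 + of_nat n) / of_nat n) * ((\<alpha> + 2 + of_nat n) / of_nat n)))
          \<longlonglongrightarrow> 1 * 1 / ((e - \<alpha> - 1) * 1 * 1)"
        using \<open>e \<noteq> \<alpha> + 1\<close> by (intro tendsto_intros lim) (auto simp: algebra_simps)
      show "\<forall>\<^sub>F n in sequentially. ((\<beta> + of_nat n) / of_nat n) * ((\<gamma> + of_nat n) / of_nat n) /
          ((e - \<alpha> - 1) * ((\<alpha> + 1 + of_nat n) / of_nat n) * ((\<alpha> + 2 + of_nat n) / of_nat n)) = D n"
        using eventually_gt_at_top[of 0] by eventually_elim (simp add: D_def add_ac)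
    qed
    moreover have "hypergeom_term 1 \<beta> \<gamma> 1 e \<longlonglongrightarrow> 0"
      using conv e by (intro hypergeom_term_tendsto_0) auto
    ultimately have "(\<lambda>n. D n * hypergeom_term 1 \<beta> \<gamma> 1 e n) \<longlonglongrightarrow>
        1 * 1 / ((e - \<alpha> - 1) * 1 * 1) * 0"
      by (rule tendsto_mult)
    then show ?thesis
      unfolding C_def hypergeom_difference_partial_sum[OF assms(1) e \<open>e \<noteq> \<alpha> + 1\<close> eq] D_def by simp
  qed
  then have "(\<lambda>k. hypergeom_term \<alpha> \<beta> \<gamma> (\<alpha> + 1) e k -
            C * hypergeom_term (\<alpha> + 2) \<beta> \<gamma> (\<alpha> + 3) e k) sums 0"
    by (simp add: sums_def_le)
  \<comment> \<open>The telescoping limit concerns only the series of differences; the separate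
    convergence of the two series allows it to be split.\<close>
  moreover have "(\<lambda>k. hypergeom_term \<alpha> \<beta> \<gamma> (\<alpha> + 1) e k -
            C * hypergeom_term (\<alpha> + 2) \<beta> \<gamma> (\<alpha> + 3) e k) sums
      (suminf (hypergeom_term \<alpha> \<beta> \<gamma> (\<alpha> + 1) e) -
       C * suminf (hypergeom_term (\<alpha> + 2) \<beta> \<gamma> (\<alpha> + 3) e))"
    using sm1 sm2 by (intro sums_diff sums_mult summable_sums)
  ultimately have "suminf (hypergeom_term \<alpha> \<beta> \<gamma> (\<alpha> + 1) e) =
       C * suminf (hypergeom_term (\<alpha> + 2) \<beta> \<gamma> (\<alpha> + 3) e)"
    using sums_unique2 by fastforce
  moreover have "C = ((\<alpha> + 1) * (\<alpha> - \<beta> + 2) * (\<alpha> - \<gamma> + 2)) / ((\<alpha> + 2) * Q)"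
    using \<alpha>1 by (simp add: C_def Q)
  ultimately show ?thesis
    unfolding hypergeom_3F2_at_1_def hypergeom_term_def e_def Q_def by simp
qed

end
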